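(* Let $S=\mathbb{F}_q[C_0,C_1,C_0^*,C_1^*,U_{-1},U_0,U_1]$ be a polynomial ring in seven variables and let $\pi:S\to \mathbb{F}_q[x_1,x_2,y_1,y_2]^{\mathrm{GL}_2(\mathbb{F}_q)}$ be the surjective $\mathbb{F}_q$-algebra homomorphism with $C_i\mapsto c_i$, $C_i^*\mapsto c_i^*$ ($i=0,1$) and $U_j\mapsto u_j$ ($j=-1,0,1$). Let $\mathcal{I}\subseteq S$ be the ideal generated by the five polynomials $$C_0U_{-1}-C_1U_0^q+U_1^q,\qquad C_0^*U_1-C_1^*U_0^q+U_{-1}^q,\qquad C_0C_0^*-(U_{-1}U_1-U_0^{q+1})^{q-1},$$ $$C_1C_0^*-C_1^*U_1^{q-1}-U_{-1}U_0\sum_{i=1}^{q-1}(-1)^i\binom{q-1}{i}(U_{-1}U_1)^{q-1-i}U_0^{(q+1)(i-1)},$$ $$C_0C_1^*-C_1U_{-1}^{q-1}-U_0U_1\sum_{i=1}^{q-1}(-1)^i\binom{q-1}{i}(U_{-1}U_1)^{q-1-i}U_0^{(q+1)(i-1)}.$$ Then $\ker(\pi)=\mathcal{I}$.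
   Context: $\mathbb{F}_q$ is the finite field with $q=p^m$ elements; $\mathrm{GL}_2(\mathbb{F}_q)$ acts on $V\oplus V^*$ with $V=\mathbb{F}_q^2$, and $\mathbb{F}_q[V\oplus V^*]=\mathbb{F}_q[x_1,x_2,y_1,y_2]$ where $x_1,x_2$ is a basis of $V^*$ dual to the basis $y_1,y_2$ of $V$, with the induced (diagonal) action. Let $*$ be the $\mathbb{F}_q$-algebra involution with $x_1\mapsto y_2$, $x_2\mapsto y_1$, $y_1\mapsto x_2$, $y_2\mapsto x_1$. Define $d_2:=x_1x_2^q-x_2x_1^q$, $d_1:=x_1x_2^{q^2}-x_2x_1^{q^2}$, $c_0:=d_2^{q-1}$, $c_1:=d_1/d_2$, and $c_0^*,c_1^*$ their $*$-images; $u_0:=x_1y_1+x_2y_2$, $u_1:=x_1^qy_1+x_2^qy_2$, $u_{-1}:=x_1y_1^q+x_2y_2^q$. It is known that $c_0,c_1,c_0^*,c_1^*,u_{-1},u_0,u_1$ generate the invariant ring $\mathbb{F}_q[x_1,x_2,y_1,y_2]^{\mathrm{GL}_2(\mathbb{F}_q)}$, so $\pi$ is surjective. *)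

theory Defs
  imports "HOL-Library.Poly_Mapping"
begin

text \<open>Multivariate polynomials over a coefficient ring, in variables indexed by nat:
  a polynomial is a finitely supported map from monomials (finitely supported
  exponent vectors) to coefficients.\<close>

type_synonym 'a mpoly = "(nat \<Rightarrow>\<^sub>0 nat) \<Rightarrow>\<^sub>0 'a"

definition Var :: "nat \<Rightarrow> 'a::comm_ring_1 mpoly" where
  "Var i = Poly_Mapping.single (Poly_Mapping.single i 1) 1"

definition Const :: "'a \<Rightarrow> 'a::comm_ring_1 mpoly" where
  "Const c = Poly_Mapping.single 0 c"

definition poly_ring :: "nat \<Rightarrow> 'a::comm_ring_1 mpoly set" where
  "poly_ring n = {p. \<forall>m \<in> Poly_Mapping.keys p. Poly_Mapping.keys m \<subseteq> {..<n}}"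

definition subst :: "(nat \<Rightarrow> 'a::comm_ring_1 mpoly) \<Rightarrow> 'a mpoly \<Rightarrow> 'a mpoly" where
  "subst f p = (\<Sum>m \<in> Poly_Mapping.keys p.
      Const (Poly_Mapping.lookup p m) * (\<Prod>i \<in> Poly_Mapping.keys m. f i ^ Poly_Mapping.lookup m i))"

abbreviation "x1 \<equiv> Var 0" abbreviation "x2 \<equiv> Var 1"
abbreviation "y1 \<equiv> Var 2" abbreviation "y2 \<equiv> Var 3"

text \<open>The involution *: x1 \<mapsto> y2, x2 \<mapsto> y1, y1 \<mapsto> x2, y2 \<mapsto> x1.\<close>
definition star :: "'a::comm_ring_1 mpoly \<Rightarrow> 'a mpoly" where
  "star p = subst (\<lambda>i. Var (3 - i)) p"

definition d2 :: "nat \<Rightarrow> 'a::comm_ring_1 mpoly" where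
  "d2 q = x1 * x2 ^ q - x2 * x1 ^ q"
definition d1 :: "nat \<Rightarrow> 'a::comm_ring_1 mpoly" where
  "d1 q = x1 * x2 ^ (q^2) - x2 * x1 ^ (q^2)"
definition c0 :: "nat \<Rightarrow> 'a::comm_ring_1 mpoly" where
  "c0 q = d2 q ^ (q - 1)"
text \<open>c1 = d1/d2, the (exact) polynomial quotient.\<close>
definition c1 :: "nat \<Rightarrow> 'a::comm_ring_1 mpoly" where
  "c1 q = (THE c. d2 q * c = d1 q)"
definition u0 :: "'a::comm_ring_1 mpoly" where
  "u0 = x1 * y1 + x2 * y2"
definition u1 :: "nat \<Rightarrow> 'a::comm_ring_1 mpoly" where
  "u1 q = x1 ^ q * y1 + x2 ^ q * y2"
definition um1 :: "nat \<Rightarrow> 'a::comm_ring_1 mpoly" where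
  "um1 q = x1 * y1 ^ q + x2 * y2 ^ q"

text \<open>S = F_q[C0,C1,C0*,C1*,U_{-1},U0,U1] with variables indexed
  C0 = 0, C1 = 1, C0* = 2, C1* = 3, U_{-1} = 4, U0 = 5, U1 = 6.\<close>
definition S_ring :: "'a::comm_ring_1 mpoly set" where
  "S_ring = poly_ring 7"

definition gen_val :: "nat \<Rightarrow> nat \<Rightarrow> 'a::comm_ring_1 mpoly" where
  "gen_val q i = (if i = 0 then c0 q else if i = 1 then c1 q
     else if i = 2 then star (c0 q) else if i = 3 then star (c1 q)
     else if i = 4 then um1 q else if i = 5 then u0 else if i = 6 then u1 q else 0)"

definition piS :: "nat \<Rightarrow> 'a::comm_ring_1 mpoly \<Rightarrow> 'a mpoly" where
  "piS q p = subst (gen_val q) p"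

definition ker_pi :: "nat \<Rightarrow> 'a::comm_ring_1 mpoly set" where
  "ker_pi q = {p \<in> S_ring. piS q p = 0}"

abbreviation "C0 \<equiv> Var 0" abbreviation "C1 \<equiv> Var 1"
abbreviation "C0s \<equiv> Var 2" abbreviation "C1s \<equiv> Var 3"
abbreviation "Um1 \<equiv> Var 4" abbreviation "U0 \<equiv> Var 5" abbreviation "U1 \<equiv> Var 6"

definition sigma_sum :: "nat \<Rightarrow> 'a::comm_ring_1 mpoly" where
  "sigma_sum q = (\<Sum>i = 1..q - 1. (-1) ^ i * of_nat ((q - 1) choose i)
      * (Um1 * U1) ^ (q - 1 - i) * U0 ^ ((q + 1) * (i - 1)))"

definition gens :: "nat \<Rightarrow> 'a::comm_ring_1 mpoly list" where
  "gens q = [C0 * Um1 - C1 * U0 ^ q + U1 ^ q,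
             C0s * U1 - C1s * U0 ^ q + Um1 ^ q,
             C0 * C0s - (Um1 * U1 - U0 ^ (q + 1)) ^ (q - 1),
             C1 * C0s - C1s * U1 ^ (q - 1) - Um1 * U0 * sigma_sum q,
             C0 * C1s - C1 * Um1 ^ (q - 1) - U0 * U1 * sigma_sum q]"

definition ideal_gen :: "'a::comm_ring_1 mpoly list \<Rightarrow> 'a mpoly set" where
  "ideal_gen gs = {(\<Sum>j < length gs. a j * gs ! j) | a. \<forall>j < length gs. a j \<in> S_ring}"

end

theory Submission
  imports Defs "HOL-Computational_Algebra.Polynomial"
begin

text \<open>
  Give $x_1, x_2, y_1, y_2$ the weights $3, 0, 0, 2$. Each of the seven invariants then has a single
  heaviest monomial: $c_0 \mapsto (x_1^q x_2)^{q-1}$, $c_1 \mapsto x_1^{q^2-q}$,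
  $c_0^* \mapsto (y_1 y_2^q)^{q-1}$, $c_1^* \mapsto y_2^{q^2-q}$, $u_{-1} \mapsto x_2 y_2^q$,
  $u_0 \mapsto x_1 y_1$, $u_1 \mapsto x_1^q y_1$. The five generators of the ideal rewrite
  $U_1^q$, $C_0^* U_1$, $C_0 C_0^*$, $C_1 C_0^*$, $C_0 C_1^*$ into strictly lighter polynomials for
  another weight on $S$, so modulo the ideal every polynomial is a linear combination of monomials
  divisible by none of these five. The images of such monomials have pairwise different heaviest
  monomials and are therefore linearly independent, so a combination in the kernel is zero.
\<close>

section \<open>Substitution\<close>

text \<open>Split off from \<open>subst\<close> because its multiplicativity in the exponent vector
  is what makes \<open>subst\<close> a ring homomorphism.\<close>

definition mon :: "(nat \<Rightarrow> 'b::comm_monoid_mult) \<Rightarrow> (nat \<Rightarrow>\<^sub>0 nat) \<Rightarrow> 'b" where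
  "mon f m = (\<Prod>i \<in> Poly_Mapping.keys m. f i ^ Poly_Mapping.lookup m i)"

lemma mon_superset:
  assumes "finite A" "Poly_Mapping.keys m \<subseteq> A"
  shows "mon f m = (\<Prod>i\<in>A. f i ^ Poly_Mapping.lookup m i)"
  unfolding mon_def by (rule prod.mono_neutral_left) (use assms in \<open>auto simp: in_keys_iff\<close>)

lemma mon_add: "mon f (m + n) = mon f m * mon f n"
proof -
  let ?A = "Poly_Mapping.keys m \<union> Poly_Mapping.keys n"
  have "mon f (m + n) = (\<Prod>i\<in>?A. f i ^ Poly_Mapping.lookup (m + n) i)"
    by (rule mon_superset) (auto simp: keys_add)
  moreover have "mon f m = (\<Prod>i\<in>?A. f i ^ Poly_Mapping.lookup m i)"
    by (rule mon_superset) auto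
  moreover have "mon f n = (\<Prod>i\<in>?A. f i ^ Poly_Mapping.lookup n i)"
    by (rule mon_superset) auto
  ultimately show ?thesis
    by (simp add: lookup_add power_add prod.distrib)
qed

lemma Const_0: "Const 0 = 0"
  and Const_1: "Const 1 = 1"
  and Const_add: "Const (a + b) = Const a + Const b"
  and Const_mult: "Const (a * b) = Const a * Const b"
  by (simp_all add: Const_def single_add mult_single)

lemma lookup_Const_mult:
  "Poly_Mapping.lookup (Const c * p) m = c * Poly_Mapping.lookup p m"
proof -
  have "Const c * p = Poly_Mapping.map ((*) c) p"
    by (simp add: Const_def mult_map_scale_conv_mult)
  then show ?thesis
    by (simp add: Poly_Mapping.map.rep_eq when_def)
qed

lemma subst_eq: "subst f p = (\<Sum>m\<in>Poly_Mapping.keys p. Const (Poly_Mapping.lookup p m) * mon f m)"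
  by (simp add: subst_def mon_def)

lemma subst_add: "subst f (p + r) = subst f p + subst f r"
  unfolding subst_eq
  by (rule setsum_keys_plus_distrib) (simp_all add: Const_0 Const_add algebra_simps)

lemma subst_single: "subst f (Poly_Mapping.single m c) = Const c * mon f m"
  by (simp add: subst_eq Const_0)

lemma subst_0: "subst f 0 = 0"
  by (simp add: subst_eq)

lemma subst_sum: "subst f (sum g A) = (\<Sum>i\<in>A. subst f (g i))"
  by (induction A rule: infinite_finite_induct) (simp_all add: subst_0 subst_add)

lemma sum_monomials:
  "p = (\<Sum>m\<in>Poly_Mapping.keys p. Poly_Mapping.single m (Poly_Mapping.lookup p m))"
  by (rule poly_mapping_eqI) (auto simp: lookup_sum lookup_single when_def in_keys_iff)

text \<open>Both sides are bilinear in \<open>p\<close> and \<open>r\<close>, so it is enough to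
  compare them on single monomials, where \<open>mon_add\<close> applies.\<close>

lemma subst_mult: "subst f (p * r) = subst f p * subst f r"
proof -
  have single: "subst f (Poly_Mapping.single m c * Poly_Mapping.single n d)
      = subst f (Poly_Mapping.single m c) * subst f (Poly_Mapping.single n d)" for m n c d
    by (simp add: mult_single subst_single mon_add Const_mult mult_ac)
  have "subst f (sum g A * sum h B) = subst f (sum g A) * subst f (sum h B)"
    if "\<And>i j. subst f (g i * h j) = subst f (g i) * subst f (h j)"
    for g h :: "(nat \<Rightarrow>\<^sub>0 nat) \<Rightarrow> 'a mpoly" and A B
    using that by (simp add: sum_product subst_sum)
  from this[of "\<lambda>m. Poly_Mapping.single m (Poly_Mapping.lookup p m)"
      "\<lambda>m. Poly_Mapping.single m (Poly_Mapping.lookup r m)", OF single,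
      of "Poly_Mapping.keys p" "Poly_Mapping.keys r"]
  show ?thesis
    by (simp flip: sum_monomials)
qed

lemma subst_Const: "subst f (Const c) = Const c"
  unfolding Const_def by (simp add: subst_single) (simp add: mon_def Const_def)

lemma subst_1: "subst f 1 = 1"
  using subst_Const[of f 1] by (simp add: Const_1)

lemma subst_Var: "subst f (Var i) = f i"
  by (simp add: Var_def subst_single mon_def Const_1)

lemma subst_uminus: "subst f (- p) = - subst f p"
  using subst_add[of f p "- p"] by (simp add: subst_0 eq_neg_iff_add_eq_0 add.commute)

lemma subst_diff: "subst f (p - r) = subst f p - subst f r"
  using subst_add[of f p "- r"] by (simp add: subst_uminus)

lemma subst_power: "subst f (p ^ n) = subst f p ^ n"
  by (induction n) (simp_all add: subst_1 subst_mult)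

lemma subst_of_nat: "subst f (of_nat n) = of_nat n"
  by (induction n) (simp_all add: subst_0 subst_1 subst_add)

lemmas subst_simps = subst_0 subst_1 subst_add subst_diff subst_uminus subst_mult subst_power
  subst_of_nat subst_sum subst_Var subst_Const

section \<open>Weights and leading monomials\<close>

definition wt :: "(nat \<Rightarrow> nat) \<Rightarrow> (nat \<Rightarrow>\<^sub>0 nat) \<Rightarrow> nat" where
  "wt w m = (\<Sum>i\<in>Poly_Mapping.keys m. w i * Poly_Mapping.lookup m i)"

lemma wt_add: "wt w (m + n) = wt w m + wt w n"
  unfolding wt_def by (rule setsum_keys_plus_distrib) (simp_all add: algebra_simps)

lemma wt_0: "wt w 0 = 0"
  by (simp add: wt_def)

lemma wt_single: "wt w (Poly_Mapping.single i n) = w i * n"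
  by (simp add: wt_def)

lemma wt_of_nat_mult: "wt w (of_nat n * m) = n * wt w m"
  by (induction n) (simp_all add: wt_0 wt_add algebra_simps)

lemma lookup_of_nat_mult:
  "Poly_Mapping.lookup (of_nat n * m) i = n * Poly_Mapping.lookup (m :: nat \<Rightarrow>\<^sub>0 nat) i"
  by (induction n) (simp_all add: lookup_add algebra_simps)

text \<open>The bound is strict, so that \<open>n = 0\<close> leaves only the zero polynomial, which
  later starts the induction on the weight. Weight at most \<open>a\<close> is written as
  \<open>wt_less w (Suc a)\<close>.\<close>

definition wt_less :: "(nat \<Rightarrow> nat) \<Rightarrow> nat \<Rightarrow> 'a::comm_ring_1 mpoly set" where
  "wt_less w n = {p. \<forall>m\<in>Poly_Mapping.keys p. wt w m < n}"

lemma wt_less_mono: "p \<in> wt_less w a \<Longrightarrow> a \<le> b \<Longrightarrow> p \<in> wt_less w b"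
  unfolding wt_less_def by force

lemma wt_less_0: "0 \<in> wt_less w n"
  by (simp add: wt_less_def)

lemma wt_less_add: "p \<in> wt_less w n \<Longrightarrow> r \<in> wt_less w n \<Longrightarrow> p + r \<in> wt_less w n"
  unfolding wt_less_def using keys_add[of p r] by blast

lemma wt_less_uminus: "p \<in> wt_less w n \<Longrightarrow> - p \<in> wt_less w n"
  by (simp add: wt_less_def in_keys_iff)

lemma wt_less_diff: "p \<in> wt_less w n \<Longrightarrow> r \<in> wt_less w n \<Longrightarrow> p - r \<in> wt_less w n"
  using wt_less_add[OF _ wt_less_uminus, of p w n r] by simp

lemma wt_less_sum: "(\<And>i. i \<in> A \<Longrightarrow> f i \<in> wt_less w n) \<Longrightarrow> sum f A \<in> wt_less w n"
  by (induction A rule: infinite_finite_induct) (simp_all add: wt_less_0 wt_less_add)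

text \<open>One strict bound is enough for a strict bound on the sum of two weights. This asymmetric
  form serves both the cross terms in \<open>lead_mult\<close> and the descent in
  \<open>reducible_if_wt_less\<close>.\<close>

lemma wt_less_mult:
  assumes "p \<in> wt_less w (Suc a)" "r \<in> wt_less w b"
  shows "p * r \<in> wt_less w (a + b)"
proof -
  have "wt w m < a + b" if "m \<in> Poly_Mapping.keys (p * r)" for m
  proof -
    from that keys_mult[of p r] obtain k l
      where "m = k + l" "k \<in> Poly_Mapping.keys p" "l \<in> Poly_Mapping.keys r"
      by blast
    with assms show ?thesis
      by (fastforce simp: wt_less_def wt_add)
  qed
  then show ?thesis
    by (simp add: wt_less_def)
qed

lemma wt_less_single: "wt w m < n \<Longrightarrow> Poly_Mapping.single m c \<in> wt_less w n"
  by (simp add: wt_less_def)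

lemma wt_le_single: "Poly_Mapping.single m c \<in> wt_less w (Suc (wt w m))"
  by (simp add: wt_less_single)

lemma wt_le_mult:
  "p \<in> wt_less w (Suc a) \<Longrightarrow> r \<in> wt_less w (Suc b) \<Longrightarrow> p * r \<in> wt_less w (Suc (a + b))"
  using wt_less_mult[of p w a r "Suc b"] by simp

lemma wt_le_1: "1 \<in> wt_less w (Suc n)"
  by (simp add: wt_less_def wt_0)

lemma wt_le_power: "p \<in> wt_less w (Suc a) \<Longrightarrow> p ^ n \<in> wt_less w (Suc (n * a))"
  by (induction n) (simp_all add: wt_le_1 wt_le_mult)

lemma wt_le_Var: "Var i \<in> wt_less w (Suc (w i))"
  unfolding Var_def by (rule wt_less_single) (simp add: wt_single)

lemma wt_le_of_nat: "of_nat k \<in> wt_less w (Suc n)"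
  by (induction k) (simp_all add: wt_less_0 wt_le_1 wt_less_add)

text \<open>The weight is no monomial order: different monomials may weigh the same. The condition
  on \<open>r\<close> therefore makes \<open>e\<close> the only monomial of maximal weight.\<close>

definition lead :: "(nat \<Rightarrow> nat) \<Rightarrow> 'a::comm_ring_1 mpoly \<Rightarrow> (nat \<Rightarrow>\<^sub>0 nat) \<Rightarrow> bool" where
  "lead w p e \<longleftrightarrow> (\<exists>c r. c \<noteq> 0 \<and> p = Poly_Mapping.single e c + r \<and> r \<in> wt_less w (wt w e))"

text \<open>The product of the leading terms has coefficient \<open>c * d\<close>, which is nonzero
  in a domain; each of the three other products has a factor that is strictly too light.\<close>

lemma lead_mult:
  fixes p r :: "'a::idom mpoly"
  assumes "lead w p e" "lead w r f"
  shows "lead w (p * r) (e + f)"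
proof -
  obtain c p' where p: "c \<noteq> 0" "p = Poly_Mapping.single e c + p'" "p' \<in> wt_less w (wt w e)"
    using assms(1) by (auto simp: lead_def)
  obtain d r' where r: "d \<noteq> 0" "r = Poly_Mapping.single f d + r'" "r' \<in> wt_less w (wt w f)"
    using assms(2) by (auto simp: lead_def)
  have "p' * Poly_Mapping.single f d \<in> wt_less w (wt w e + wt w f)"
    using wt_less_mult[OF wt_le_single p(3), of f d] by (simp add: mult.commute add.commute)
  moreover have "Poly_Mapping.single e c * r' \<in> wt_less w (wt w e + wt w f)"
    by (rule wt_less_mult[OF wt_le_single r(3)])
  moreover have "p' * r' \<in> wt_less w (wt w e + wt w f)"
    using wt_less_mult[OF wt_less_mono[OF p(3)] r(3)] by simp
  ultimately have "p' * Poly_Mapping.single f d + Poly_Mapping.single e c * r' + p' * r'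
      \<in> wt_less w (wt w (e + f))"
    by (simp add: wt_add wt_less_add)
  moreover have "p * r = Poly_Mapping.single (e + f) (c * d)
      + (p' * Poly_Mapping.single f d + Poly_Mapping.single e c * r' + p' * r')"
    by (simp add: p(2) r(2) algebra_simps mult_single)
  ultimately show ?thesis
    unfolding lead_def using p(1) r(1) by (metis no_zero_divisors)
qed

lemma lead_1: "lead w 1 0"
  unfolding lead_def by (intro exI[of _ 1] exI[of _ 0]) (simp add: wt_less_0)

lemma lead_power: "lead w p e \<Longrightarrow> lead w (p ^ n) (of_nat n * e)" for p :: "'a::idom mpoly"
  by (induction n) (simp_all add: lead_1 lead_mult algebra_simps)

lemma lead_prod:
  fixes p :: "'b \<Rightarrow> 'a::idom mpoly"
  shows "(\<And>i. i \<in> A \<Longrightarrow> lead w (p i) (e i)) \<Longrightarrow> lead w (prod p A) (sum e A)"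
  by (induction A rule: infinite_finite_induct) (simp_all add: lead_1 lead_mult)

lemma lead_Var: "lead w (Var i) (Poly_Mapping.single i 1)"
  unfolding lead_def Var_def by (intro exI[of _ 1] exI[of _ 0]) (simp add: wt_less_0)

lemma lead_add: "lead w p e \<Longrightarrow> r \<in> wt_less w (wt w e) \<Longrightarrow> lead w (p + r) e"
  unfolding lead_def by (metis add.assoc wt_less_add)

lemma lead_uminus: "lead w p e \<Longrightarrow> lead w (- p) e"
  unfolding lead_def
  by (metis minus_add_distrib neg_equal_0_iff_equal single_uminus wt_less_uminus)

lemma lookup_lead_nonzero: "lead w p e \<Longrightarrow> Poly_Mapping.lookup p e \<noteq> 0"
  by (auto simp: lead_def lookup_add wt_less_def in_keys_iff)

lemma lookup_lead_eq_0:
  assumes "lead w p e" "wt w e \<le> wt w m" "m \<noteq> e"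
  shows "Poly_Mapping.lookup p m = 0"
proof -
  obtain c r where r: "p = Poly_Mapping.single e c + r" "r \<in> wt_less w (wt w e)"
    using assms(1) by (auto simp: lead_def)
  then have "m \<notin> Poly_Mapping.keys r"
    using assms(2) by (auto simp: wt_less_def)
  then show ?thesis
    using assms(3) by (simp add: r(1) lookup_add lookup_single_not_eq in_keys_iff)
qed

text \<open>Among the indices with nonzero coefficient take \<open>k0\<close> whose leading monomial
  is heaviest, and compare coefficients at \<open>E k0\<close>. Every other \<open>P k\<close> that
  occurs is no heavier and has a different leading monomial, so it contributes nothing
  there.\<close>

lemma lead_independent:
  fixes P :: "'b \<Rightarrow> 'a::idom mpoly"
  assumes "finite K" "inj_on E K" and lead: "\<And>k. k \<in> K \<Longrightarrow> lead w (P k) (E k)"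
    and zero: "(\<Sum>k\<in>K. Const (a k) * P k) = 0" and "k \<in> K"
  shows "a k = 0"
proof (rule ccontr)
  assume "a k \<noteq> 0"
  define K' where "K' = {k\<in>K. a k \<noteq> 0}"
  have K': "finite K'" "K' \<noteq> {}"
    using assms \<open>a k \<noteq> 0\<close> by (auto simp: K'_def)
  then have "Max ((\<lambda>k. wt w (E k)) ` K') \<in> (\<lambda>k. wt w (E k)) ` K'"
    by (intro Max_in) auto
  then obtain k0 where k0: "k0 \<in> K'" "wt w (E k0) = Max ((\<lambda>k. wt w (E k)) ` K')"
    by force
  then have max: "wt w (E k) \<le> wt w (E k0)" if "k \<in> K'" for k
    using that K'(1) by (auto intro: Max_ge)
  have "0 = (\<Sum>k\<in>K. a k * Poly_Mapping.lookup (P k) (E k0))"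
    using arg_cong[OF zero, of "\<lambda>p. Poly_Mapping.lookup p (E k0)"]
    by (simp add: lookup_sum lookup_Const_mult)
  also have "\<dots> = (\<Sum>k\<in>{k0}. a k * Poly_Mapping.lookup (P k) (E k0))"
  proof (rule sum.mono_neutral_right)
    show "\<forall>k\<in>K - {k0}. a k * Poly_Mapping.lookup (P k) (E k0) = 0"
    proof
      fix k assume k: "k \<in> K - {k0}"
      then have "E k0 \<noteq> E k"
        using assms(2) k0(1) by (auto simp: K'_def inj_on_def)
      with k show "a k * Poly_Mapping.lookup (P k) (E k0) = 0"
        using lookup_lead_eq_0[OF lead max, of k] by (cases "a k = 0") (auto simp: K'_def)
    qed
  qed (use assms(1) k0(1) in \<open>auto simp: K'_def\<close>)
  finally show False
    using k0(1) lookup_lead_nonzero[OF lead, of k0] by (simp add: K'_def)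
qed

section \<open>The Frobenius map\<close>

text \<open>Multiplication by a nonzero \<open>x\<close> permutes the nonzero elements; comparing
  their product before and after shows that the power of \<open>x\<close> with exponent q - 1 is
  1.\<close>

lemma power_card_eq_self:
  fixes x :: "'a::{field, finite}"
  shows "x ^ card (UNIV :: 'a set) = x"
proof (cases "x = 0")
  case False
  have "(\<Prod>y\<in>UNIV - {0}. x * y) = \<Prod>(UNIV - {0})"
    by (rule prod.reindex_bij_witness[of _ "\<lambda>y. y / x" "(*) x"]) (use False in auto)
  then have "x ^ card (UNIV - {0 :: 'a}) * \<Prod>(UNIV - {0}) = \<Prod>(UNIV - {0})"
    by (simp add: prod.distrib)
  then have "x ^ card (UNIV - {0 :: 'a}) = 1"
    by simp
  moreover have "card (UNIV :: 'a set) = Suc (card (UNIV - {0 :: 'a}))"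
    by (rule card.remove) auto
  ultimately show ?thesis
    by (metis mult.right_neutral power_Suc)
qed (simp add: finite_UNIV_card_ge_0)

lemma card_field_ge_2: "2 \<le> card (UNIV :: 'a::{field, finite} set)"
  using card_mono[of "UNIV :: 'a set" "{0, 1}"] by simp

text \<open>The polynomial $(X+1)^q - X^q - 1$ has degree less than $q$ and $q$ roots.\<close>
lemma of_nat_card_choose:
  assumes "0 < i" "i < card (UNIV :: 'a set)"
  shows "of_nat (card (UNIV :: 'a set) choose i) = (0 :: 'a::{field, finite})"
proof -
  define q where "q = card (UNIV :: 'a set)"
  define f :: "'a Polynomial.poly" where "f = (\<Sum>k=1..<q. Polynomial.monom (of_nat (q choose k)) k)"
  have "q \<ge> 2"
    using card_field_ge_2[where 'a = 'a] by (simp add: q_def)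
  have eval: "Polynomial.poly f x = 0" for x
  proof -
    have "x + 1 = (x + 1) ^ q"
      using power_card_eq_self[of "x + 1"] by (simp add: q_def)
    also have "\<dots> = (\<Sum>k\<le>q. of_nat (q choose k) * x ^ k)"
      by (simp add: binomial_ring)
    also have "{..q} = insert 0 (insert q {1..<q})"
      using \<open>q \<ge> 2\<close> by auto
    also have "(\<Sum>k\<in>insert 0 (insert q {1..<q}). of_nat (q choose k) * x ^ k)
        = 1 + (x ^ q + Polynomial.poly f x)"
      using \<open>q \<ge> 2\<close> by (simp add: f_def poly_sum poly_monom)
    finally show ?thesis
      using power_card_eq_self[of x] by (simp add: q_def)
  qed
  have "f = 0"
  proof (rule ccontr)
    assume "f \<noteq> 0"
    have "Polynomial.degree f \<le> q - 1"
      unfolding f_def by (rule degree_sum_le) (auto intro: order_trans[OF degree_monom_le])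
    moreover have "q \<le> Polynomial.degree f"
      using card_poly_roots_bound[OF \<open>f \<noteq> 0\<close>] eval by (simp add: q_def)
    ultimately show False
      using \<open>q \<ge> 2\<close> by simp
  qed
  then have "Polynomial.coeff f i = 0"
    by simp
  then show ?thesis
    using assms by (simp add: f_def coeff_sum q_def)
qed

lemma of_nat_mpoly: "of_nat n = (Const (of_nat n) :: 'a::comm_ring_1 mpoly)"
  by (simp add: Const_def)

text \<open>The inner binomial coefficients vanish already in the coefficient field, so only the two
  outer terms of the binomial expansion survive.\<close>

lemma frobenius_add:
  fixes a b :: "'a::{field, finite} mpoly"
  assumes "card (UNIV :: 'a set) = q"
  shows "(a + b) ^ q = a ^ q + b ^ q"
proof -
  have "q \<ge> 2"
    using card_field_ge_2[where 'a = 'a] assms by simp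
  have "(a + b) ^ q = (\<Sum>k\<le>q. of_nat (q choose k) * a ^ k * b ^ (q - k))"
    by (simp add: binomial_ring)
  also have "\<dots> = (\<Sum>k\<in>{0, q}. of_nat (q choose k) * a ^ k * b ^ (q - k))"
  proof (rule sum.mono_neutral_right)
    show "\<forall>k\<in>{..q} - {0, q}. of_nat (q choose k) * a ^ k * b ^ (q - k) = 0"
      using of_nat_card_choose[where 'a = 'a] assms
      by (auto simp: of_nat_mpoly Const_0 simp del: single_of_nat)
  qed auto
  finally show ?thesis
    using \<open>q \<ge> 2\<close> by (simp add: add.commute)
qed

section \<open>The relations hold\<close>

text \<open>With n = q - 1 the left factor is x y (y^n - x^n), and the right side is x y (y^(n(q+1))
  - x^(n(q+1))) because q^2 - 1 = n(q+1). The sum is the usual cofactor of a difference of (q+1)-st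
  powers.\<close>

lemma c1_exact:
  fixes x y :: "'b::comm_ring_1"
  assumes "q > 0"
  shows "(x * y ^ q - y * x ^ q) * (\<Sum>i<Suc q. (y ^ (q - 1)) ^ (q - i) * (x ^ (q - 1)) ^ i)
    = x * y ^ q\<^sup>2 - y * x ^ q\<^sup>2"
proof -
  define n where "n = q - 1"
  have q: "q = Suc n"
    using assms by (simp add: n_def)
  have "q\<^sup>2 = Suc (n * Suc q)"
    by (simp add: q power2_eq_square)
  then have "x * y ^ q\<^sup>2 - y * x ^ q\<^sup>2 = - (x * y) * ((x ^ n) ^ Suc q - (y ^ n) ^ Suc q)"
    by (simp add: power_mult[symmetric] algebra_simps del: power_Suc) (simp add: algebra_simps)
  also have "(x ^ n) ^ Suc q - (y ^ n) ^ Suc q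
      = (x ^ n - y ^ n) * (\<Sum>i<Suc q. (y ^ n) ^ (q - i) * (x ^ n) ^ i)"
    using power_diff_sumr2[of "x ^ n" "Suc q" "y ^ n"] by simp
  also have "- (x * y) * ((x ^ n - y ^ n) * (\<Sum>i<Suc q. (y ^ n) ^ (q - i) * (x ^ n) ^ i))
      = (x * y ^ q - y * x ^ q) * (\<Sum>i<Suc q. (y ^ n) ^ (q - i) * (x ^ n) ^ i)"
    unfolding mult.assoc[symmetric] by (rule arg_cong[of _ _ "\<lambda>t. t * _"]) (simp add: q algebra_simps)
  finally show ?thesis
    by (simp add: n_def)
qed

text \<open>\<open>x\<close> and \<open>y\<close> are roots of the Dickson polynomial T^(q^2) - c
  T^q + d^(q-1) T, where d = x y^q - y x^q. Frobenius gives d^q = x^q y^(q^2) - y^q x^(q^2), so both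
  equations become polynomial identities after multiplication by d, which can be cancelled.\<close>

lemma dickson_root:
  fixes x y c :: "'b::idom"
  assumes diff: "\<And>a b :: 'b. (a - b) ^ q = a ^ q - b ^ q" and "q > 0"
    and "x * y ^ q - y * x ^ q \<noteq> 0"
    and c: "(x * y ^ q - y * x ^ q) * c = x * y ^ q\<^sup>2 - y * x ^ q\<^sup>2"
  shows "x ^ q\<^sup>2 = c * x ^ q - (x * y ^ q - y * x ^ q) ^ (q - 1) * x"
    and "y ^ q\<^sup>2 = c * y ^ q - (x * y ^ q - y * x ^ q) ^ (q - 1) * y"
proof -
  define d where "d = x * y ^ q - y * x ^ q"
  have "d * d ^ (q - 1) = d ^ q"
    using \<open>q > 0\<close> by (simp flip: power_Suc)
  also have "\<dots> = x ^ q * y ^ q\<^sup>2 - y ^ q * x ^ q\<^sup>2"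
    by (simp add: d_def diff power_mult_distrib power2_eq_square flip: power_mult)
  finally have dq: "d * d ^ (q - 1) = x ^ q * y ^ q\<^sup>2 - y ^ q * x ^ q\<^sup>2" .
  have "d * (c * x ^ q - d ^ (q - 1) * x) = (d * c) * x ^ q - (d * d ^ (q - 1)) * x"
    by (simp add: algebra_simps)
  also have "\<dots> = d * x ^ q\<^sup>2"
    unfolding dq c[folded d_def] by (simp add: d_def algebra_simps)
  finally show "x ^ q\<^sup>2 = c * x ^ q - (x * y ^ q - y * x ^ q) ^ (q - 1) * x"
    using assms(3) unfolding d_def[symmetric] by (metis mult_cancel_left)
  have "d * (c * y ^ q - d ^ (q - 1) * y) = (d * c) * y ^ q - (d * d ^ (q - 1)) * y"
    by (simp add: algebra_simps)
  also have "\<dots> = d * y ^ q\<^sup>2"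
    unfolding dq c[folded d_def] by (simp add: d_def algebra_simps)
  finally show "y ^ q\<^sup>2 = c * y ^ q - (x * y ^ q - y * x ^ q) ^ (q - 1) * y"
    using assms(3) unfolding d_def[symmetric] by (metis mult_cancel_left)
qed

text \<open>Multiply the Dickson equation for \<open>x\<close> by x'^q and that for \<open>y\<close>
  by y'^q, then add. The elements are kept abstract so that the involution * needs no second
  proof.\<close>

lemma relation_1:
  fixes x y x' y' c :: "'b::idom"
  assumes add: "\<And>a b :: 'b. (a + b) ^ q = a ^ q + b ^ q" and "q > 0"
    and "x * y ^ q - y * x ^ q \<noteq> 0"
    and "(x * y ^ q - y * x ^ q) * c = x * y ^ q\<^sup>2 - y * x ^ q\<^sup>2"
  shows "(x * y ^ q - y * x ^ q) ^ (q - 1) * (x * x' ^ q + y * y' ^ q)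
    - c * (x * x' + y * y') ^ q + (x ^ q * x' + y ^ q * y') ^ q = 0"
proof -
  have diff: "(a - b) ^ q = a ^ q - b ^ q" for a b :: 'b
    using add[of "a - b" b] by simp
  note root = dickson_root[OF diff assms(2-4)]
  have "(x ^ q * x' + y ^ q * y') ^ q = x ^ q\<^sup>2 * x' ^ q + y ^ q\<^sup>2 * y' ^ q"
    by (simp add: add power_mult_distrib power2_eq_square flip: power_mult)
  then show ?thesis
    by (simp only: root add) (simp add: algebra_simps power_mult_distrib)
qed

text \<open>This is the quotient of (A - B)^(q-1) - A^(q-1) by B, written without division.\<close>

definition binom_tail :: "nat \<Rightarrow> 'b::comm_ring_1 \<Rightarrow> 'b \<Rightarrow> 'b" where
  "binom_tail q A B = (\<Sum>i = 1..q - 1. (-1) ^ i * of_nat ((q - 1) choose i) * A ^ (q - 1 - i) * B ^ (i - 1))"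

lemma binom_tail: "(A - B) ^ (q - 1) = A ^ (q - 1) + B * binom_tail q A B"
proof -
  have "(A - B) ^ (q - 1) = (- B + A) ^ (q - 1)"
    by simp
  also have "\<dots> = (\<Sum>i\<le>q - 1. of_nat ((q - 1) choose i) * (- B) ^ i * A ^ (q - 1 - i))"
    by (rule binomial_ring)
  also have "{..q - 1} = insert 0 {1..q - 1}"
    by auto
  also have "(\<Sum>i\<in>insert 0 {1..q - 1}. of_nat ((q - 1) choose i) * (- B) ^ i * A ^ (q - 1 - i))
      = A ^ (q - 1) + (\<Sum>i = 1..q - 1. of_nat ((q - 1) choose i) * (- B) ^ i * A ^ (q - 1 - i))"
    by simp
  also have "(\<Sum>i = 1..q - 1. of_nat ((q - 1) choose i) * (- B) ^ i * A ^ (q - 1 - i))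
      = B * binom_tail q A B"
    unfolding binom_tail_def sum_distrib_left
  proof (rule sum.cong)
    fix i assume "i \<in> {1..q - 1}"
    then have "B ^ i = B * B ^ (i - 1)"
      by (simp flip: power_Suc)
    then show "of_nat ((q - 1) choose i) * (- B) ^ i * A ^ (q - 1 - i)
        = B * ((-1) ^ i * of_nat ((q - 1) choose i) * A ^ (q - 1 - i) * B ^ (i - 1))"
      by (simp add: power_minus[of B] mult_ac)
  qed simp
  finally show ?thesis .
qed

text \<open>After multiplication by u^q the first two relations eliminate c1 u^q and c1' u^q, and
  what remains is \<open>v\<close> times the third relation expanded by \<open>binom_tail\<close>.
  Since \<open>u\<close> is nonzero, u^q can be cancelled.\<close>

lemma relation_4:
  fixes c0 c1 c0' c1' u v w :: "'b::idom"
  assumes "q > 0" "u \<noteq> 0"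
    and r1: "c0 * v - c1 * u ^ q + w ^ q = 0"
    and r2: "c0' * w - c1' * u ^ q + v ^ q = 0"
    and r3: "c0 * c0' - (v * w - u ^ (q + 1)) ^ (q - 1) = 0"
  shows "c1 * c0' - c1' * w ^ (q - 1) - v * u * binom_tail q (v * w) (u ^ (q + 1)) = 0"
proof -
  let ?s = "binom_tail q (v * w) (u ^ (q + 1))"
  have pow: "w ^ q = w * w ^ (q - 1)" "v ^ q = v * v ^ (q - 1)"
    using \<open>q > 0\<close> by (simp_all flip: power_Suc)
  have r3': "c0 * c0' = v ^ (q - 1) * w ^ (q - 1) + u ^ (q + 1) * ?s"
    using r3 unfolding binom_tail by (simp add: power_mult_distrib)
  have "u ^ q * (c1 * c0' - c1' * w ^ (q - 1) - v * u * ?s)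
      = c0' * (c1 * u ^ q) - (c1' * u ^ q) * w ^ (q - 1) - v * (u ^ (q + 1) * ?s)"
    by (simp add: algebra_simps)
  also have "c1 * u ^ q = c0 * v + w * w ^ (q - 1)"
    using r1 unfolding pow by (simp add: algebra_simps)
  also have "c1' * u ^ q = c0' * w + v * v ^ (q - 1)"
    using r2 unfolding pow by (simp add: algebra_simps)
  also have "c0' * (c0 * v + w * w ^ (q - 1)) - (c0' * w + v * v ^ (q - 1)) * w ^ (q - 1)
      - v * (u ^ (q + 1) * ?s) = v * (c0 * c0' - v ^ (q - 1) * w ^ (q - 1) - u ^ (q + 1) * ?s)"
    by (simp add: algebra_simps)
  also have "\<dots> = 0"
    by (simp add: r3')
  finally show ?thesis
    using \<open>u \<noteq> 0\<close> by simp
qed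

lemma sigma_sum_eq: "sigma_sum q = binom_tail q (Um1 * U1) (U0 ^ (q + 1))"
  unfolding sigma_sum_def binom_tail_def by (simp only: power_mult)

lemma subst_binom_tail: "subst f (binom_tail q A B) = binom_tail q (subst f A) (subst f B)"
  by (simp add: binom_tail_def subst_simps)

lemma piS_gens:
  assumes "q > 0" and "u0 \<noteq> (0 :: 'a mpoly)"
    and rels: "c0 q * um1 q - c1 q * u0 ^ q + u1 q ^ q = (0 :: 'a mpoly)"
      "star (c0 q) * u1 q - star (c1 q) * u0 ^ q + um1 q ^ q = (0 :: 'a mpoly)"
      "c0 q * star (c0 q) - (um1 q * u1 q - u0 ^ (q + 1)) ^ (q - 1) = (0 :: 'a mpoly)"
    and "g \<in> set (gens q)"
  shows "piS q g = (0 :: 'a::idom mpoly)"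
proof -
  have g: "gen_val q 0 = c0 q" "gen_val q 1 = c1 q" "gen_val q 2 = star (c0 q)"
    "gen_val q 3 = star (c1 q)" "gen_val q 4 = um1 q" "gen_val q 5 = u0" "gen_val q 6 = u1 q"
    by (simp_all add: gen_val_def)
  have rel4: "c1 q * star (c0 q) - star (c1 q) * u1 q ^ (q - 1)
      - um1 q * u0 * binom_tail q (um1 q * u1 q) (u0 ^ (q + 1)) = (0 :: 'a mpoly)"
    by (rule relation_4[OF assms(1-5)])
  \<comment> \<open>The fifth relation is the fourth with starred and unstarred invariants
    exchanged, which also exchanges u_{-1} and u_1.\<close>
  have rel5: "star (c1 q) * c0 q - c1 q * um1 q ^ (q - 1)
      - u1 q * u0 * binom_tail q (u1 q * um1 q) (u0 ^ (q + 1)) = (0 :: 'a mpoly)"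
    by (rule relation_4[OF assms(1,2) rels(2,1)]) (use rels(3) in \<open>simp add: mult.commute\<close>)
  show ?thesis
    using assms(6) rels rel4 rel5
    unfolding gens_def piS_def sigma_sum_eq
    by (auto simp: subst_simps subst_binom_tail g g(2)[simplified] mult.commute mult.left_commute)
qed

section \<open>Dickson invariants and the leading monomials of the seven generators\<close>

text \<open>The explicit cofactor from \<open>c1_exact\<close>. The index pair (0, 1) belongs to
  c_1; since * sends index i to 3 - i, the pair (3, 2) belongs to its image.\<close>

definition dickson_quot :: "nat \<Rightarrow> nat \<Rightarrow> nat \<Rightarrow> 'a::comm_ring_1 mpoly" where
  "dickson_quot q i j = (\<Sum>k<Suc q. (Var j ^ (q - 1)) ^ (q - k) * (Var i ^ (q - 1)) ^ k)"

definition dickson_det :: "nat \<Rightarrow> nat \<Rightarrow> nat \<Rightarrow> 'a::comm_ring_1 mpoly" where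
  "dickson_det q i j = Var i * Var j ^ q - Var j * Var i ^ q"

text \<open>The two terms differ in weight by (q - 1)(w i - w j), in favour of the one with
  \<open>Var i ^ q\<close>.\<close>

lemma lead_dickson_det:
  assumes "w j < w i" "q > 1"
  shows "lead w (dickson_det q i j :: 'a::idom mpoly)
    (Poly_Mapping.single j 1 + of_nat q * Poly_Mapping.single i 1)"
proof -
  have "w i + q * w j < w j + q * w i"
  proof -
    obtain n where q: "q = Suc (Suc n)"
      using less_imp_Suc_add[OF \<open>q > 1\<close>] by auto
    have "n * w j \<le> n * w i"
      using \<open>w j < w i\<close> by simp
    then show ?thesis
      using \<open>w j < w i\<close> by (simp add: q add_less_le_mono)
  qed
  then have "Var i * Var j ^ q \<in> wt_less w
      (wt w (Poly_Mapping.single j 1 + of_nat q * Poly_Mapping.single i 1))"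
    by (intro wt_less_mono[OF wt_le_mult[OF wt_le_Var wt_le_power[OF wt_le_Var]]])
      (simp add: wt_add wt_of_nat_mult wt_single)
  moreover have "lead w (- (Var j * Var i ^ q) :: 'a mpoly)
      (Poly_Mapping.single j 1 + of_nat q * Poly_Mapping.single i 1)"
    by (intro lead_uminus lead_mult lead_power lead_Var)
  ultimately have "lead w (- (Var j * Var i ^ q) + Var i * Var j ^ q :: 'a mpoly)
      (Poly_Mapping.single j 1 + of_nat q * Poly_Mapping.single i 1)"
    by (rule lead_add[rotated])
  then show ?thesis
    by (simp add: dickson_det_def)
qed

text \<open>All summands have the same degree, so the heaviest is the one for k = q, which involves
  only the heavier variable.\<close>

lemma lead_dickson_quot:
  assumes "w j < w i" "q > 1"
  shows "lead w (dickson_quot q i j :: 'a::idom mpoly)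
    (of_nat q * (of_nat (q - 1) * Poly_Mapping.single i 1))" (is "lead _ _ ?e")
proof -
  have "(Var j ^ (q - 1)) ^ (q - k) * (Var i ^ (q - 1)) ^ k \<in> wt_less w (wt w ?e)"
    if "k < q" for k
  proof -
    have "(q - k) * w j + k * w i < (q - k) * w i + k * w i"
      using assms that by simp
    also have "\<dots> = q * w i"
      using that by (simp flip: add_mult_distrib)
    finally have "(q - 1) * ((q - k) * w j + k * w i) < (q - 1) * (q * w i)"
      using assms by simp
    then have "Suc ((q - k) * ((q - 1) * w j) + k * ((q - 1) * w i)) \<le> wt w ?e"
      by (simp add: wt_of_nat_mult wt_single add_mult_distrib2 mult.left_commute del: of_nat_diff)
    then show ?thesis
      by (rule wt_less_mono[rotated]) (intro wt_le_mult wt_le_power wt_le_Var)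
  qed
  then have "(\<Sum>k<q. (Var j ^ (q - 1)) ^ (q - k) * (Var i ^ (q - 1)) ^ k :: 'a mpoly)
      \<in> wt_less w (wt w ?e)"
    by (intro wt_less_sum) simp
  moreover have "lead w ((Var i ^ (q - 1)) ^ q :: 'a mpoly) ?e"
    by (intro lead_power lead_Var)
  ultimately have "lead w ((Var i ^ (q - 1)) ^ q +
      (\<Sum>k<q. (Var j ^ (q - 1)) ^ (q - k) * (Var i ^ (q - 1)) ^ k) :: 'a mpoly) ?e"
    by (rule lead_add[rotated])
  then show ?thesis
    by (simp add: dickson_quot_def add.commute)
qed

lemma lead_nonzero: "lead w p e \<Longrightarrow> p \<noteq> 0"
  using lookup_lead_nonzero by force

text \<open>A weight that counts only \<open>Var i\<close> separates the two terms for any pair of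
  distinct indices.\<close>

lemma dickson_det_nonzero:
  assumes "q > 1" "i \<noteq> j"
  shows "dickson_det q i j \<noteq> (0 :: 'a::idom mpoly)"
  by (rule lead_nonzero[OF lead_dickson_det[where w = "\<lambda>k. if k = i then 1 else 0"]])
    (use assms in auto)

lemma dickson_det_quot:
  assumes "q > 0"
  shows "dickson_det q i j * dickson_quot q i j = Var i * Var j ^ q\<^sup>2 - Var j * Var i ^ q\<^sup>2"
  unfolding dickson_det_def dickson_quot_def by (rule c1_exact[OF assms])

text \<open>The definite description in \<open>c1\<close> has a unique witness because the
  determinant is nonzero in a domain.\<close>

lemma c1_eq:
  assumes "q > 1"
  shows "c1 q = (dickson_quot q 0 1 :: 'a::idom mpoly)"
proof -
  have "d2 q = (dickson_det q 0 1 :: 'a mpoly)"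
    by (simp add: d2_def dickson_det_def)
  moreover have "dickson_det q 0 1 * dickson_quot q 0 1 = (d1 q :: 'a mpoly)"
    using dickson_det_quot[of q 0 1] assms by (simp add: d1_def)
  moreover have "dickson_det q 0 1 \<noteq> (0 :: 'a mpoly)"
    by (rule dickson_det_nonzero[OF assms]) simp
  ultimately show ?thesis
    unfolding c1_def by (intro the_equality) (metis mult_cancel_left)+
qed

lemma star_c1_eq: "q > 1 \<Longrightarrow> star (c1 q) = (dickson_quot q 3 2 :: 'a::idom mpoly)"
  unfolding c1_eq star_def dickson_quot_def by (simp add: subst_simps)

lemma c0_eq: "c0 q = dickson_det q 0 1 ^ (q - 1)"
  by (simp add: c0_def d2_def dickson_det_def)

lemma star_c0_eq: "star (c0 q) = dickson_det q 3 2 ^ (q - 1)"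
  by (simp add: c0_eq star_def dickson_det_def subst_simps)

text \<open>With these weights every generator of the invariant ring has a single heaviest monomial.\<close>
definition xy_weight :: "nat \<Rightarrow> nat" where
  "xy_weight i = (if i = 0 then 3 else if i = 3 then 2 else 0)"

text \<open>The exponents have exactly the shape produced by \<open>lead_mult\<close> and
  \<open>lead_power\<close>. The last branch is meant for index 6.\<close>

definition lead_exp :: "nat \<Rightarrow> nat \<Rightarrow> nat \<Rightarrow>\<^sub>0 nat" where
  "lead_exp q i =
    (if i = 0 then of_nat (q - 1) * (Poly_Mapping.single 1 1 + of_nat q * Poly_Mapping.single 0 1)
     else if i = 1 then of_nat q * (of_nat (q - 1) * Poly_Mapping.single 0 1)
     else if i = 2 then of_nat (q - 1) * (Poly_Mapping.single 2 1 + of_nat q * Poly_Mapping.single 3 1)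
     else if i = 3 then of_nat q * (of_nat (q - 1) * Poly_Mapping.single 3 1)
     else if i = 4 then Poly_Mapping.single 1 1 + of_nat q * Poly_Mapping.single 3 1
     else if i = 5 then Poly_Mapping.single 0 1 + Poly_Mapping.single 2 1
     else of_nat q * Poly_Mapping.single 0 1 + Poly_Mapping.single 2 1)"

text \<open>The terms weigh 3 and 2; this is why x_1 must be heavier than y_2.\<close>

lemma lead_u0: "lead xy_weight (u0 :: 'a::idom mpoly) (lead_exp q 5)"
proof -
  have "x2 * y2 \<in> wt_less xy_weight (wt xy_weight (lead_exp q 5))"
    by (rule wt_less_mono[OF wt_le_mult[OF wt_le_Var wt_le_Var]])
      (simp add: lead_exp_def wt_add wt_single xy_weight_def)
  then show ?thesis
    unfolding u0_def
    by (intro lead_add) (simp_all add: lead_exp_def lead_mult lead_Var[simplified])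
qed

lemma lead_u1:
  assumes "q > 1"
  shows "lead xy_weight (u1 q :: 'a::idom mpoly) (lead_exp q 6)"
proof -
  have "x2 ^ q * y2 \<in> wt_less xy_weight (wt xy_weight (lead_exp q 6))"
    by (rule wt_less_mono[OF wt_le_mult[OF wt_le_power[OF wt_le_Var] wt_le_Var]])
      (use assms in \<open>simp add: lead_exp_def wt_add wt_single wt_of_nat_mult xy_weight_def\<close>)
  then show ?thesis
    unfolding u1_def
    by (intro lead_add) (simp_all add: lead_exp_def lead_mult lead_power lead_Var[simplified])
qed

text \<open>The terms weigh 2q and 3, so y_2 must not be too light compared with x_1; 2q > 3 holds
  from q = 2 on.\<close>

lemma lead_um1:
  assumes "q > 1"
  shows "lead xy_weight (um1 q :: 'a::idom mpoly) (lead_exp q 4)"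
proof -
  have "x1 * y1 ^ q \<in> wt_less xy_weight (wt xy_weight (lead_exp q 4))"
    by (rule wt_less_mono[OF wt_le_mult[OF wt_le_Var wt_le_power[OF wt_le_Var]]])
      (use assms in \<open>simp add: lead_exp_def wt_add wt_single wt_of_nat_mult xy_weight_def\<close>)
  then have "lead xy_weight (x2 * y2 ^ q + x1 * y1 ^ q :: 'a mpoly) (lead_exp q 4)"
    by (intro lead_add) (simp_all add: lead_exp_def lead_mult lead_power lead_Var[simplified])
  then show ?thesis
    by (simp add: um1_def add.commute)
qed

lemma lead_gen_val:
  assumes "q > 1" "i < 7"
  shows "lead xy_weight (gen_val q i :: 'a::idom mpoly) (lead_exp q i)"
proof -
  note det = lead_power[OF lead_dickson_det[of xy_weight, OF _ assms(1)], where 'a = 'a]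
  note quot = lead_dickson_quot[of xy_weight, OF _ assms(1), where 'a = 'a]
  have "lead xy_weight (c0 q :: 'a mpoly) (lead_exp q 0)"
    "lead xy_weight (c1 q :: 'a mpoly) (lead_exp q 1)"
    "lead xy_weight (star (c0 q) :: 'a mpoly) (lead_exp q 2)"
    "lead xy_weight (star (c1 q) :: 'a mpoly) (lead_exp q 3)"
    unfolding star_c1_eq[OF assms(1)] star_c0_eq unfolding c1_eq[OF assms(1)] c0_eq
    using det[of 1 0 "q - 1"] det[of 2 3 "q - 1"] quot[of 1 0] quot[of 2 3]
    by (simp_all add: lead_exp_def xy_weight_def)
  moreover have "i \<in> {0, 1, 2, 3, 4, 5, 6}"
    using assms(2) by auto
  ultimately show ?thesis
    using lead_u0[of q, where 'a = 'a] lead_u1[OF assms(1), where 'a = 'a]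
      lead_um1[OF assms(1), where 'a = 'a]
    by (auto simp: gen_val_def)
qed

lemma piS_gens_eq_0:
  fixes g :: "'a::{field, finite} mpoly"
  assumes "card (UNIV :: 'a set) = q" "g \<in> set (gens q)"
  shows "piS q g = 0"
proof -
  have q: "q > 1"
    using card_field_ge_2[where 'a = 'a] assms(1) by simp
  then have "q > 0"
    by simp
  note add = frobenius_add[OF assms(1)]
  show ?thesis
  proof (rule piS_gens[OF \<open>q > 0\<close> lead_nonzero[OF lead_u0] _ _ _ assms(2)])
    show "c0 q * um1 q - c1 q * u0 ^ q + u1 q ^ q = (0 :: 'a mpoly)"
      unfolding c0_eq c1_eq[OF q] um1_def u0_def u1_def dickson_det_def
      by (rule relation_1[OF add \<open>q > 0\<close>])
        (use dickson_det_nonzero[OF q, of 0 1, where 'a = 'a]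
            dickson_det_quot[OF \<open>q > 0\<close>, of 0 1, where 'a = 'a]
          in \<open>simp_all add: dickson_det_def\<close>)
    \<comment> \<open>The second relation is \<open>relation_1\<close> for the pair y2, y1 with
      partners x2, x1.\<close>
    have "dickson_det q 3 2 ^ (q - 1) * (y2 * x2 ^ q + y1 * x1 ^ q)
      - dickson_quot q 3 2 * (y2 * x2 + y1 * x1) ^ q + (y2 ^ q * x2 + y1 ^ q * x1) ^ q
      = (0 :: 'a mpoly)"
      unfolding dickson_det_def
      by (rule relation_1[OF add \<open>q > 0\<close>])
        (use dickson_det_nonzero[OF q, of 3 2, where 'a = 'a]
            dickson_det_quot[OF \<open>q > 0\<close>, of 3 2, where 'a = 'a]
          in \<open>simp_all add: dickson_det_def\<close>)
    then show "star (c0 q) * u1 q - star (c1 q) * u0 ^ q + um1 q ^ q = (0 :: 'a mpoly)"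
      unfolding star_c0_eq star_c1_eq[OF q] um1_def u0_def u1_def by (simp add: ac_simps)
    \<comment> \<open>Up to sign this is the determinant of the matrix with rows (u_0, u_{-1}) and
      (u_1, u_0^q), which is the product of a matrix in the x variables and one in the y
      variables.\<close>
    have "um1 q * u1 q - u0 ^ (q + 1) = (dickson_det q 0 1 * dickson_det q 3 2 :: 'a mpoly)"
      by (simp add: um1_def u0_def u1_def dickson_det_def add algebra_simps power_mult_distrib)
    then show "c0 q * star (c0 q) - (um1 q * u1 q - u0 ^ (q + 1)) ^ (q - 1) = (0 :: 'a mpoly)"
      unfolding star_c0_eq by (simp add: c0_eq power_mult_distrib)
  qed
qed

section \<open>Reduction to normal monomials\<close>

text \<open>The weight counts the forbidden variables, so membership means weight 0. Closure under
  sums and products then follows from the lemmas on \<open>wt_less\<close>.\<close>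

lemma poly_ring_eq: "poly_ring n = wt_less (\<lambda>i. if i < n then 0 else 1) 1"
proof -
  have "Poly_Mapping.keys m \<subseteq> {..<n} \<longleftrightarrow> wt (\<lambda>i. if i < n then 0 else 1) m < 1" for m :: "nat \<Rightarrow>\<^sub>0 nat"
    by (auto simp: wt_def in_keys_iff)
  then show ?thesis
    unfolding poly_ring_def wt_less_def by simp
qed

lemma S_ring_mult: "p \<in> S_ring \<Longrightarrow> r \<in> S_ring \<Longrightarrow> p * r \<in> S_ring"
  using wt_less_mult[of p _ 0 r 1] by (simp add: S_ring_def poly_ring_eq)

lemma S_ring_0: "0 \<in> S_ring"
  and S_ring_add: "p \<in> S_ring \<Longrightarrow> r \<in> S_ring \<Longrightarrow> p + r \<in> S_ring"
  and S_ring_diff: "p \<in> S_ring \<Longrightarrow> r \<in> S_ring \<Longrightarrow> p - r \<in> S_ring"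
  and S_ring_uminus: "p \<in> S_ring \<Longrightarrow> - p \<in> S_ring"
  and S_ring_sum: "(\<And>i. i \<in> A \<Longrightarrow> f i \<in> S_ring) \<Longrightarrow> sum f A \<in> S_ring"
  by (simp_all add: S_ring_def poly_ring_eq wt_less_0 wt_less_add wt_less_diff wt_less_uminus wt_less_sum)

lemma S_ring_1: "1 \<in> S_ring"
  and S_ring_of_nat: "of_nat n \<in> S_ring"
  unfolding S_ring_def poly_ring_eq
  using wt_le_1[of _ 0] wt_le_of_nat[of n _ 0] by simp_all

lemma S_ring_Var: "i < 7 \<Longrightarrow> Var i \<in> S_ring"
  by (simp add: S_ring_def poly_ring_def Var_def)

lemma S_ring_single: "Poly_Mapping.keys m \<subseteq> {..<7} \<Longrightarrow> Poly_Mapping.single m c \<in> S_ring"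
  by (simp add: S_ring_def poly_ring_def)

lemma S_ring_power: "p \<in> S_ring \<Longrightarrow> p ^ n \<in> S_ring"
  by (induction n) (simp_all add: S_ring_1 S_ring_mult)

lemmas S_ring_intros = S_ring_mult S_ring_0 S_ring_add S_ring_diff S_ring_uminus S_ring_sum
  S_ring_1 S_ring_of_nat S_ring_Var S_ring_power

lemma S_ring_sigma_sum: "sigma_sum q \<in> S_ring"
  unfolding sigma_sum_def by (intro S_ring_intros) simp_all

lemma S_ring_gens: "g \<in> set (gens q) \<Longrightarrow> g \<in> S_ring"
  unfolding gens_def by (auto intro!: S_ring_intros S_ring_sigma_sum)

lemma ideal_gen_add:
  assumes "p \<in> ideal_gen gs" "r \<in> ideal_gen gs"
  shows "p + r \<in> ideal_gen gs"
proof -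
  obtain a b where "p = (\<Sum>j<length gs. a j * gs ! j)" "r = (\<Sum>j<length gs. b j * gs ! j)"
    "\<forall>j<length gs. a j \<in> S_ring" "\<forall>j<length gs. b j \<in> S_ring"
    using assms by (auto simp: ideal_gen_def)
  then have "p + r = (\<Sum>j<length gs. (a j + b j) * gs ! j)"
    "\<forall>j<length gs. a j + b j \<in> S_ring"
    by (simp_all add: sum.distrib algebra_simps S_ring_add)
  then show ?thesis
    unfolding ideal_gen_def mem_Collect_eq by (intro exI[of _ "\<lambda>j. a j + b j"] conjI)
qed

lemma ideal_gen_mult:
  assumes "p \<in> ideal_gen gs" "s \<in> S_ring"
  shows "s * p \<in> ideal_gen gs"
proof -
  obtain a where "p = (\<Sum>j<length gs. a j * gs ! j)" "\<forall>j<length gs. a j \<in> S_ring"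
    using assms by (auto simp: ideal_gen_def)
  then have "s * p = (\<Sum>j<length gs. (s * a j) * gs ! j)" "\<forall>j<length gs. s * a j \<in> S_ring"
    using assms(2) by (simp_all add: sum_distrib_left mult.assoc S_ring_mult)
  then show ?thesis
    unfolding ideal_gen_def mem_Collect_eq by (intro exI[of _ "\<lambda>j. s * a j"] conjI)
qed

lemma ideal_gen_0: "0 \<in> ideal_gen gs"
  unfolding ideal_gen_def by (auto intro!: exI[of _ "\<lambda>_. 0"] simp: S_ring_0)

lemma ideal_gen_base:
  assumes "k < length gs"
  shows "gs ! k \<in> ideal_gen gs"
proof -
  have "gs ! k = (\<Sum>j<length gs. if j = k then gs ! j else 0)"
    using assms by simp
  also have "\<dots> = (\<Sum>j<length gs. (if j = k then 1 else 0) * gs ! j)"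
    by (intro sum.cong) auto
  finally show ?thesis
    unfolding ideal_gen_def mem_Collect_eq
    by (intro exI[of _ "\<lambda>j. if j = k then 1 else 0"] conjI) (simp_all add: S_ring_0 S_ring_1)
qed

text \<open>The monomials that are divisible by none of
  $U_1^q$, $C_0^* U_1$, $C_0 C_0^*$, $C_1 C_0^*$, $C_0 C_1^*$.\<close>
definition normal :: "nat \<Rightarrow> (nat \<Rightarrow>\<^sub>0 nat) \<Rightarrow> bool" where
  "normal q m \<longleftrightarrow> Poly_Mapping.keys m \<subseteq> {..<7} \<and> (let e = Poly_Mapping.lookup m in
    e 6 < q \<and> (e 2 = 0 \<or> e 6 = 0) \<and> (e 0 = 0 \<or> e 2 = 0) \<and> (e 1 = 0 \<or> e 2 = 0) \<and> (e 0 = 0 \<or> e 3 = 0))"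

text \<open>For these weights the monomials just listed are strictly heavier than every other
  monomial of the generator in which they occur.\<close>
definition S_weight :: "nat \<Rightarrow> nat \<Rightarrow> nat" where
  "S_weight q i = (if i = 2 then 2 * q else if i = 3 then q else if i = 6 then 1 else 0)"

lemma Var_power: "Var i ^ n = Poly_Mapping.single (Poly_Mapping.single i n) 1"
  by (induction n) (simp_all add: Var_def mult_single flip: single_add)

lemma Var_mult_Var:
  "Var i * Var j = Poly_Mapping.single (Poly_Mapping.single i 1 + Poly_Mapping.single j 1) 1"
  by (simp add: Var_def mult_single)

text \<open>Only \<open>U1\<close> has positive weight here, and its exponent q - 1 - i is at most q
  - 2 because the sum starts at i = 1.\<close>

lemma sigma_sum_wt: "sigma_sum q \<in> wt_less (S_weight q) (Suc (q - 2))"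
proof -
  have "-1 \<in> wt_less (S_weight q) (Suc 0)"
    by (intro wt_less_uminus wt_le_1)
  from wt_le_power[OF this] have m1: "(-1) ^ i \<in> wt_less (S_weight q) (Suc 0)" for i
    by simp
  have "(-1) ^ i * of_nat ((q - 1) choose i) * (Um1 * U1) ^ (q - 1 - i) * U0 ^ ((q + 1) * (i - 1))
      \<in> wt_less (S_weight q) (Suc (0 + 0 + (q - 1 - i) * (S_weight q 4 + S_weight q 6)
          + (q + 1) * (i - 1) * S_weight q 5))" for i
    by (intro wt_le_mult m1 wt_le_of_nat wt_le_power wt_le_Var)
  then show ?thesis
    unfolding sigma_sum_def
    by (intro wt_less_sum) (rule wt_less_mono, assumption, auto simp: S_weight_def)
qed

text \<open>\<open>L\<close> is one of the five excluded monomials dividing \<open>m\<close>, and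
  \<open>T\<close> is \<open>L\<close> minus the corresponding generator. In the order of the cases,
  the weight of \<open>L\<close> against the bound for \<open>T\<close> is q > 0, 2q + 1 > q, 2q > q
  - 1, 2q > 2q - 1 and q > q - 1.\<close>

lemma reduction_rule:
  fixes q :: nat
  assumes "q > 1" "Poly_Mapping.keys m \<subseteq> {..<7}" "\<not> normal q m"
  obtains L and T :: "'a::comm_ring_1 mpoly"
  where "\<And>i. Poly_Mapping.lookup L i \<le> Poly_Mapping.lookup m i" "T \<in> S_ring"
    "T \<in> wt_less (S_weight q) (wt (S_weight q) L)"
    "Poly_Mapping.single L 1 - T \<in> ideal_gen (gens q)"
proof -
  let ?e = "Poly_Mapping.lookup m" and ?v = "S_weight q"
  have gens: "gens q ! k \<in> ideal_gen (gens q :: 'a mpoly list)" if "k < 5" for k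
    by (rule ideal_gen_base) (use that in \<open>simp add: gens_def\<close>)
  note Var_le = wt_le_Var[of _ ?v]
  have weights: "?v 0 = 0" "?v 1 = 0" "?v 2 = 2 * q" "?v 3 = q" "?v 4 = 0" "?v 5 = 0" "?v 6 = 1"
    by (simp_all add: S_weight_def)
  consider "?e 6 \<ge> q" | "?e 2 > 0" "?e 6 > 0" | "?e 0 > 0" "?e 2 > 0" | "?e 1 > 0" "?e 2 > 0"
    | "?e 0 > 0" "?e 3 > 0"
    using assms(2,3) unfolding normal_def Let_def by linarith
  then show ?thesis
  proof cases
    case 1
    show ?thesis
    proof (rule that)
      show "Poly_Mapping.lookup (Poly_Mapping.single 6 q) i \<le> ?e i" for i
        using 1 by (simp add: lookup_single when_def)
      show "C1 * U0 ^ q - C0 * Um1 \<in> S_ring"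
        by (intro S_ring_intros) simp_all
      have "C1 * U0 ^ q \<in> wt_less ?v (Suc (?v 1 + q * ?v 5))" "C0 * Um1 \<in> wt_less ?v (Suc (?v 0 + ?v 4))"
        by (intro wt_le_mult wt_le_power Var_le)+
      then show "C1 * U0 ^ q - C0 * Um1 \<in> wt_less ?v (wt ?v (Poly_Mapping.single 6 q))"
        using assms(1) unfolding weights wt_single
        by (intro wt_less_diff) (erule wt_less_mono, simp)+
      show "Poly_Mapping.single (Poly_Mapping.single 6 q) 1 - (C1 * U0 ^ q - C0 * Um1)
          \<in> ideal_gen (gens q :: 'a mpoly list)"
        using gens[of 0] by (simp add: gens_def algebra_simps flip: Var_power)
    qed
  next
    case 2
    show ?thesis
    proof (rule that)
      show "Poly_Mapping.lookup (Poly_Mapping.single 2 1 + Poly_Mapping.single 6 1) i \<le> ?e i" for i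
        using 2 by (simp add: lookup_add lookup_single when_def)
      show "C1s * U0 ^ q - Um1 ^ q \<in> S_ring"
        by (intro S_ring_intros) simp_all
      have "C1s * U0 ^ q \<in> wt_less ?v (Suc (?v 3 + q * ?v 5))" "Um1 ^ q \<in> wt_less ?v (Suc (q * ?v 4))"
        by (intro wt_le_mult wt_le_power Var_le)+
      then show "C1s * U0 ^ q - Um1 ^ q
          \<in> wt_less ?v (wt ?v (Poly_Mapping.single 2 1 + Poly_Mapping.single 6 1))"
        unfolding weights wt_single wt_add
        by (intro wt_less_diff) (erule wt_less_mono, simp)+
      show "Poly_Mapping.single (Poly_Mapping.single 2 1 + Poly_Mapping.single 6 1) 1
          - (C1s * U0 ^ q - Um1 ^ q) \<in> ideal_gen (gens q :: 'a mpoly list)"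
        using gens[of 1] unfolding Var_mult_Var[symmetric] by (simp add: gens_def algebra_simps)
    qed
  next
    case 3
    show ?thesis
    proof (rule that)
      show "Poly_Mapping.lookup (Poly_Mapping.single 0 1 + Poly_Mapping.single 2 1) i \<le> ?e i" for i
        using 3 by (simp add: lookup_add lookup_single when_def)
      show "(Um1 * U1 - U0 ^ (q + 1)) ^ (q - 1) \<in> S_ring"
        by (intro S_ring_intros) simp_all
      have "Um1 * U1 \<in> wt_less ?v (Suc (?v 4 + ?v 6))" "U0 ^ (q + 1) \<in> wt_less ?v (Suc ((q + 1) * ?v 5))"
        by (intro wt_le_mult wt_le_power Var_le)+
      then have "Um1 * U1 - U0 ^ (q + 1) \<in> wt_less ?v (Suc 1)"
        unfolding weights by (intro wt_less_diff) (erule wt_less_mono, simp)+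
      then have "(Um1 * U1 - U0 ^ (q + 1)) ^ (q - 1) \<in> wt_less ?v (Suc ((q - 1) * 1))"
        by (rule wt_le_power)
      then show "(Um1 * U1 - U0 ^ (q + 1)) ^ (q - 1)
          \<in> wt_less ?v (wt ?v (Poly_Mapping.single 0 1 + Poly_Mapping.single 2 1))"
        by (rule wt_less_mono) (use assms(1) in \<open>simp add: weights wt_single wt_add\<close>)
      show "Poly_Mapping.single (Poly_Mapping.single 0 1 + Poly_Mapping.single 2 1) 1
          - (Um1 * U1 - U0 ^ (q + 1)) ^ (q - 1) \<in> ideal_gen (gens q :: 'a mpoly list)"
        using gens[of 2] unfolding Var_mult_Var[symmetric] by (simp add: gens_def)
    qed
  next
    case 4
    show ?thesis
    proof (rule that)
      show "Poly_Mapping.lookup (Poly_Mapping.single 1 1 + Poly_Mapping.single 2 1) i \<le> ?e i" for i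
        using 4 by (auto simp: lookup_add lookup_single when_def)
      show "C1s * U1 ^ (q - 1) + Um1 * U0 * sigma_sum q \<in> S_ring"
        by (intro S_ring_intros S_ring_sigma_sum) simp_all
      \<comment> \<open>The tight case: the first term weighs q + (q - 1), which explains the weight
        2q of C_0^*.\<close>
      have "C1s * U1 ^ (q - 1) \<in> wt_less ?v (Suc (?v 3 + (q - 1) * ?v 6))"
        "Um1 * U0 * sigma_sum q \<in> wt_less ?v (Suc (?v 4 + ?v 5 + (q - 2)))"
        by (intro wt_le_mult wt_le_power Var_le sigma_sum_wt)+
      then show "C1s * U1 ^ (q - 1) + Um1 * U0 * sigma_sum q
          \<in> wt_less ?v (wt ?v (Poly_Mapping.single 1 1 + Poly_Mapping.single 2 1))"
        using assms(1) unfolding weights wt_single wt_add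
        by (intro wt_less_add) (erule wt_less_mono, simp)+
      show "Poly_Mapping.single (Poly_Mapping.single 1 1 + Poly_Mapping.single 2 1) 1
          - (C1s * U1 ^ (q - 1) + Um1 * U0 * sigma_sum q) \<in> ideal_gen (gens q :: 'a mpoly list)"
        using gens[of 3] unfolding Var_mult_Var[symmetric] by (simp add: gens_def algebra_simps)
    qed
  next
    case 5
    show ?thesis
    proof (rule that)
      show "Poly_Mapping.lookup (Poly_Mapping.single 0 1 + Poly_Mapping.single 3 1) i \<le> ?e i" for i
        using 5 by (simp add: lookup_add lookup_single when_def)
      show "C1 * Um1 ^ (q - 1) + U0 * U1 * sigma_sum q \<in> S_ring"
        by (intro S_ring_intros S_ring_sigma_sum) simp_all
      have "C1 * Um1 ^ (q - 1) \<in> wt_less ?v (Suc (?v 1 + (q - 1) * ?v 4))"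
        "U0 * U1 * sigma_sum q \<in> wt_less ?v (Suc (?v 5 + ?v 6 + (q - 2)))"
        by (intro wt_le_mult wt_le_power Var_le sigma_sum_wt)+
      then show "C1 * Um1 ^ (q - 1) + U0 * U1 * sigma_sum q
          \<in> wt_less ?v (wt ?v (Poly_Mapping.single 0 1 + Poly_Mapping.single 3 1))"
        using assms(1) unfolding weights wt_single wt_add
        by (intro wt_less_add) (erule wt_less_mono, simp)+
      show "Poly_Mapping.single (Poly_Mapping.single 0 1 + Poly_Mapping.single 3 1) 1
          - (C1 * Um1 ^ (q - 1) + U0 * U1 * sigma_sum q) \<in> ideal_gen (gens q :: 'a mpoly list)"
        using gens[of 4] unfolding Var_mult_Var[symmetric] by (simp add: gens_def algebra_simps)
    qed
  qed
qed

section \<open>Normal forms modulo the ideal\<close>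

definition reducible :: "nat \<Rightarrow> 'a::comm_ring_1 mpoly \<Rightarrow> bool" where
  "reducible q p \<longleftrightarrow> (\<exists>r. (\<forall>m\<in>Poly_Mapping.keys r. normal q m) \<and> p - r \<in> ideal_gen (gens q))"

lemma reducible_0: "reducible q 0"
  unfolding reducible_def by (intro exI[of _ 0]) (simp add: ideal_gen_0)

lemma reducible_add:
  assumes "reducible q p" "reducible q p'"
  shows "reducible q (p + p')"
proof -
  obtain r r' where "\<forall>m\<in>Poly_Mapping.keys r. normal q m" "p - r \<in> ideal_gen (gens q)"
    and "\<forall>m\<in>Poly_Mapping.keys r'. normal q m" "p' - r' \<in> ideal_gen (gens q)"
    using assms by (auto simp: reducible_def)
  then have "\<forall>m\<in>Poly_Mapping.keys (r + r'). normal q m" "(p + p') - (r + r') \<in> ideal_gen (gens q)"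
    using keys_add[of r r'] ideal_gen_add[of "p - r" "gens q" "p' - r'"]
    by (auto simp: algebra_simps)
  then show ?thesis
    unfolding reducible_def by blast
qed

lemma reducible_sum: "(\<And>i. i \<in> A \<Longrightarrow> reducible q (f i)) \<Longrightarrow> reducible q (sum f A)"
  by (induction A rule: infinite_finite_induct) (simp_all add: reducible_0 reducible_add)

lemma reducible_ideal: "p - r \<in> ideal_gen (gens q) \<Longrightarrow> reducible q r \<Longrightarrow> reducible q p"
  unfolding reducible_def using ideal_gen_add[of "p - r" "gens q"] by fastforce

text \<open>Induction on the weight bound, one monomial at a time. A monomial that is not normal is
  a multiple of some \<open>L\<close> from \<open>reduction_rule\<close>; replacing \<open>L\<close>
  by \<open>T\<close> strictly lowers the weight.\<close>

lemma reducible_if_wt_less: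
  assumes "q > 1"
  shows "p \<in> S_ring \<Longrightarrow> p \<in> wt_less (S_weight q) n \<Longrightarrow> reducible q p"
proof (induction n arbitrary: p)
  case 0
  then have "Poly_Mapping.keys p = {}"
    by (auto simp: wt_less_def)
  then show ?case
    by (simp add: reducible_0)
next
  case (Suc n)
  have "reducible q (Poly_Mapping.single m c)"
    if keys: "Poly_Mapping.keys m \<subseteq> {..<7}" and le: "wt (S_weight q) m \<le> n" for m and c :: 'a
  proof (cases "normal q m")
    case True
    then show ?thesis
      unfolding reducible_def
      by (intro exI[of _ "Poly_Mapping.single m c"]) (simp add: ideal_gen_0)
  next
    case False
    obtain L and T :: "'a mpoly" where L: "\<And>i. Poly_Mapping.lookup L i \<le> Poly_Mapping.lookup m i"
      and T: "T \<in> S_ring" "T \<in> wt_less (S_weight q) (wt (S_weight q) L)"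
        "Poly_Mapping.single L 1 - T \<in> ideal_gen (gens q)"
      by (rule reduction_rule[OF assms keys False]) blast
    \<comment> \<open>Subtraction of exponents is truncated, so recovering \<open>m\<close> as
      \<open>k + L\<close> rests on \<open>L\<close> dividing \<open>m\<close>.\<close>
    define k where "k = m - L"
    have m: "m = k + L"
      by (rule poly_mapping_eqI) (simp add: k_def lookup_add lookup_minus L)
    let ?s = "Poly_Mapping.single k c"
    have "Poly_Mapping.keys k \<subseteq> Poly_Mapping.keys m"
      by (auto simp: k_def in_keys_iff lookup_minus)
    then have s: "?s \<in> S_ring"
      using keys by (intro S_ring_single) blast
    have "?s * T \<in> wt_less (S_weight q) (wt (S_weight q) k + wt (S_weight q) L)"
      by (rule wt_less_mult[OF wt_le_single T(2)])
    then have "?s * T \<in> wt_less (S_weight q) n"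
      by (rule wt_less_mono) (use le in \<open>simp add: m wt_add\<close>)
    then have "reducible q (?s * T)"
      by (intro Suc.IH S_ring_mult s T(1))
    moreover have "?s * (Poly_Mapping.single L 1 - T) = Poly_Mapping.single m c - ?s * T"
      by (simp add: algebra_simps mult_single m)
    then have "Poly_Mapping.single m c - ?s * T \<in> ideal_gen (gens q)"
      using ideal_gen_mult[OF T(3) s] by (rule subst)
    ultimately show ?thesis
      by (rule reducible_ideal[rotated])
  qed
  then have "reducible q (\<Sum>m\<in>Poly_Mapping.keys p. Poly_Mapping.single m (Poly_Mapping.lookup p m))"
    using Suc.prems by (intro reducible_sum) (auto simp: S_ring_def poly_ring_def wt_less_def less_Suc_eq_le)
  then show ?case
    by (simp flip: sum_monomials)
qed

lemma S_ring_reducible: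
  assumes "q > 1" "p \<in> S_ring"
  shows "reducible q p"
proof -
  \<comment> \<open>Any bound may start the induction; the sum of all weights dominates each of
    them.\<close>
  have "p \<in> wt_less (S_weight q) (Suc (\<Sum>m\<in>Poly_Mapping.keys p. wt (S_weight q) m))"
    by (auto simp: wt_less_def less_Suc_eq_le intro: member_le_sum)
  then show ?thesis
    by (rule reducible_if_wt_less[OF assms])
qed

section \<open>Independence of the normal monomials\<close>

definition lead_mon :: "nat \<Rightarrow> (nat \<Rightarrow>\<^sub>0 nat) \<Rightarrow> nat \<Rightarrow>\<^sub>0 nat" where
  "lead_mon q m = (\<Sum>i\<in>Poly_Mapping.keys m. of_nat (Poly_Mapping.lookup m i) * lead_exp q i)"

lemma lead_mon_gen_val:
  assumes "q > 1" "Poly_Mapping.keys m \<subseteq> {..<7}"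
  shows "lead xy_weight (mon (gen_val q) m :: 'a::idom mpoly) (lead_mon q m)"
  unfolding mon_def lead_mon_def
  by (intro lead_prod lead_power lead_gen_val) (use assms in auto)

text \<open>Reading off the exponents of x_1, x_2, y_1, y_2 turns injectivity of
  \<open>lead_mon\<close> into four linear equations over the natural numbers.\<close>

lemma lookup_lead_mon:
  assumes "Poly_Mapping.keys m \<subseteq> {..<7}"
  defines "e \<equiv> Poly_Mapping.lookup m"
  shows "Poly_Mapping.lookup (lead_mon q m) 0 = q * (q - 1) * e 0 + q * (q - 1) * e 1 + e 5 + q * e 6"
    "Poly_Mapping.lookup (lead_mon q m) 1 = (q - 1) * e 0 + e 4"
    "Poly_Mapping.lookup (lead_mon q m) 2 = (q - 1) * e 2 + e 5 + e 6"
    "Poly_Mapping.lookup (lead_mon q m) 3 = q * (q - 1) * e 2 + q * (q - 1) * e 3 + q * e 4"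
proof -
  have "Poly_Mapping.lookup (lead_mon q m) j = (\<Sum>i<7. e i * Poly_Mapping.lookup (lead_exp q i) j)" for j
    unfolding lead_mon_def lookup_sum lookup_of_nat_mult e_def
    by (rule sum.mono_neutral_left) (use assms(1) in \<open>auto simp: in_keys_iff\<close>)
  also have "(\<Sum>i<7. f i) = f 0 + f 1 + f 2 + f 3 + f 4 + f 5 + f 6" for f :: "nat \<Rightarrow> nat"
    by (simp add: eval_nat_numeral)
  finally have *: "Poly_Mapping.lookup (lead_mon q m) j = e 0 * Poly_Mapping.lookup (lead_exp q 0) j
      + e 1 * Poly_Mapping.lookup (lead_exp q 1) j + e 2 * Poly_Mapping.lookup (lead_exp q 2) j
      + e 3 * Poly_Mapping.lookup (lead_exp q 3) j + e 4 * Poly_Mapping.lookup (lead_exp q 4) j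
      + e 5 * Poly_Mapping.lookup (lead_exp q 5) j + e 6 * Poly_Mapping.lookup (lead_exp q 6) j" for j .
  show "Poly_Mapping.lookup (lead_mon q m) 0 = q * (q - 1) * e 0 + q * (q - 1) * e 1 + e 5 + q * e 6"
    "Poly_Mapping.lookup (lead_mon q m) 1 = (q - 1) * e 0 + e 4"
    "Poly_Mapping.lookup (lead_mon q m) 2 = (q - 1) * e 2 + e 5 + e 6"
    "Poly_Mapping.lookup (lead_mon q m) 3 = q * (q - 1) * e 2 + q * (q - 1) * e 3 + q * e 4"
    unfolding *
    by (simp_all add: lead_exp_def lookup_of_nat_mult lookup_add lookup_single
        mult.commute[of "e _"] mult.left_commute[of "e _"] del: of_nat_diff)
qed

text \<open>The two differences $x_1 - y_1$ and $q x_2 - y_2$ of exponents decide whether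
  $C_0^*$ and $C_0$ occur.\<close>
lemma normal_exponents_unique:
  fixes q n :: nat and a b :: "nat \<Rightarrow> nat"
  assumes q: "q = Suc n" and "n > 0"
    and a: "a 6 < q" "a 2 = 0 \<or> a 6 = 0" "a 0 = 0 \<or> a 2 = 0" "a 1 = 0 \<or> a 2 = 0" "a 0 = 0 \<or> a 3 = 0"
    and b: "b 6 < q" "b 2 = 0 \<or> b 6 = 0" "b 0 = 0 \<or> b 2 = 0" "b 1 = 0 \<or> b 2 = 0" "b 0 = 0 \<or> b 3 = 0"
    and x1: "q * n * a 0 + q * n * a 1 + a 5 + q * a 6 = q * n * b 0 + q * n * b 1 + b 5 + q * b 6"
    and x2: "n * a 0 + a 4 = n * b 0 + b 4"
    and y1: "n * a 2 + a 5 + a 6 = n * b 2 + b 5 + b 6"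
    and y2: "q * n * a 2 + q * n * a 3 + q * a 4 = q * n * b 2 + q * n * b 3 + q * b 4"
    and "i < 7"
  shows "a i = b i"
proof -
  \<comment> \<open>In the difference of the exponents of x_1 and y_1 the exponent of U_0 cancels,
    and the factor n = q - 1 comes out.\<close>
  have "n * int (q * (a 0 + a 1) + a 6) - n * a 2 = n * int (q * (b 0 + b 1) + b 6) - n * b 2"
  proof -
    have "int (q * n * a 0 + q * n * a 1 + a 5 + q * a 6) - int (n * a 2 + a 5 + a 6)
       = int (q * n * b 0 + q * n * b 1 + b 5 + q * b 6) - int (n * b 2 + b 5 + b 6)"
      using x1 y1 by simp
    then show ?thesis
      by (simp add: q algebra_simps)
  qed
  then have "int n * (int (q * (a 0 + a 1) + a 6) - a 2) = int n * (int (q * (b 0 + b 1) + b 6) - b 2)"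
    by (simp add: right_diff_distrib)
  then have *: "int (q * (a 0 + a 1) + a 6) - a 2 = int (q * (b 0 + b 1) + b 6) - b 2"
    using \<open>n > 0\<close> by simp
  \<comment> \<open>For a normal monomial at most one of the two natural numbers in the difference
    is nonzero, so the difference determines both.\<close>
  have "a 2 = 0 \<or> q * (a 0 + a 1) + a 6 = 0" "b 2 = 0 \<or> q * (b 0 + b 1) + b 6 = 0"
    using a b by auto
  then have eq2: "a 2 = b 2" and eq: "q * (a 0 + a 1) + a 6 = q * (b 0 + b 1) + b 6"
    using * by linarith+
  \<comment> \<open>Since the exponent of U_1 is below q, it is the remainder modulo q.\<close>
  have eq6: "a 6 = b 6"
    using arg_cong[OF eq, of "\<lambda>t. t mod q"] a(1) b(1) by simp
  have "q > 0"
    by (simp add: q)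
  then have eq01: "a 0 + a 1 = b 0 + b 1"
    using eq eq6 by simp
  have eq5: "a 5 = b 5"
    using y1 eq2 eq6 by simp
  have y2': "n * a 3 + a 4 = n * b 3 + b 4"
  proof -
    have "q * (n * a 3 + a 4) = q * (n * b 3 + b 4)"
      using y2 eq2 by (simp add: algebra_simps)
    then show ?thesis
      using \<open>q > 0\<close> by simp
  qed
  \<comment> \<open>The same argument with C_0 and C_1^*, which never occur together; here the
    exponent of U_{-1} cancels.\<close>
  have "int n * (int (a 0) - a 3) = int n * (int (b 0) - b 3)"
  proof -
    have "int (n * a 0 + a 4) - int (n * a 3 + a 4) = int (n * b 0 + b 4) - int (n * b 3 + b 4)"
      using x2 y2' by simp
    then show ?thesis
      by (simp add: algebra_simps)
  qed
  then have "int (a 0) - a 3 = int (b 0) - b 3"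
    using \<open>n > 0\<close> by simp
  then have eq03: "a 0 = b 0" "a 3 = b 3"
    using a(5) b(5) by linarith+
  then have eq4: "a 4 = b 4" "a 1 = b 1"
    using x2 eq01 by simp_all
  have "i \<in> {0, 1, 2, 3, 4, 5, 6}"
    using \<open>i < 7\<close> by auto
  then show ?thesis
    using eq2 eq6 eq5 eq03 eq4 by auto
qed

lemma inj_on_lead_mon:
  assumes "q > 1"
  shows "inj_on (lead_mon q) {m. normal q m}"
proof (rule inj_onI)
  fix m m' assume m: "m \<in> {m. normal q m}" "m' \<in> {m. normal q m}" and eq: "lead_mon q m = lead_mon q m'"
  have keys: "Poly_Mapping.keys m \<subseteq> {..<7}" "Poly_Mapping.keys m' \<subseteq> {..<7}"
    using m by (simp_all add: normal_def)
  have normal: "normal q m" "normal q m'"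
    using m by simp_all
  note exps = lookup_lead_mon[OF keys(1), of q, unfolded eq lookup_lead_mon[OF keys(2)], symmetric]
  show "m = m'"
  proof (rule poly_mapping_eqI)
    fix i
    show "Poly_Mapping.lookup m i = Poly_Mapping.lookup m' i"
    proof (cases "i < 7")
      case True
      show ?thesis
        by (rule normal_exponents_unique[OF _ _ _ _ _ _ _ _ _ _ _ _ exps True])
          (use normal assms in \<open>simp_all add: normal_def Let_def\<close>)
    next
      case False
      then have "i \<notin> Poly_Mapping.keys m" "i \<notin> Poly_Mapping.keys m'"
        using keys by auto
      then show ?thesis
        by (simp add: in_keys_iff)
    qed
  qed
qed

lemma normal_piS_eq_0:
  fixes r :: "'a::idom mpoly"
  assumes "q > 1" "\<forall>m\<in>Poly_Mapping.keys r. normal q m" "piS q r = 0"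
  shows "r = 0"
proof -
  have "Poly_Mapping.lookup r m = 0" if "m \<in> Poly_Mapping.keys r" for m
  proof (rule lead_independent[where K = "Poly_Mapping.keys r" and E = "lead_mon q"
        and w = xy_weight and P = "mon (gen_val q)"])
    show "inj_on (lead_mon q) (Poly_Mapping.keys r)"
      using inj_on_subset[OF inj_on_lead_mon[OF assms(1)]] assms(2) by blast
    show "lead xy_weight (mon (gen_val q) k :: 'a mpoly) (lead_mon q k)"
      if "k \<in> Poly_Mapping.keys r" for k
      by (rule lead_mon_gen_val[OF assms(1)]) (use assms(2) that in \<open>simp add: normal_def\<close>)
    show "(\<Sum>k\<in>Poly_Mapping.keys r. Const (Poly_Mapping.lookup r k) * mon (gen_val q) k) = 0"
      using assms(3) by (simp add: piS_def subst_eq)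
  qed (use that in auto)
  then show ?thesis
    by (intro poly_mapping_eqI) (auto simp: in_keys_iff)
qed

section \<open>The two inclusions between kernel and ideal\<close>

lemma ideal_gen_subset_ker:
  fixes p :: "'a::{field, finite} mpoly"
  assumes "card (UNIV :: 'a set) = q" "p \<in> ideal_gen (gens q)"
  shows "p \<in> ker_pi q"
proof -
  let ?gs = "gens q :: 'a mpoly list"
  obtain a where p: "p = (\<Sum>j<length ?gs. a j * ?gs ! j)" "\<forall>j<length ?gs. a j \<in> S_ring"
    using assms(2) unfolding ideal_gen_def by blast
  have "p \<in> S_ring"
    unfolding p(1) using p(2) by (intro S_ring_sum S_ring_mult) (auto intro: S_ring_gens[of _ q])
  moreover have "piS q p = (\<Sum>j<length ?gs. piS q (a j) * piS q (?gs ! j))"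
    by (simp add: p(1) piS_def subst_sum subst_mult)
  moreover have "\<dots> = 0"
    by (intro sum.neutral) (simp add: piS_gens_eq_0[OF assms(1)])
  ultimately show ?thesis
    by (simp add: ker_pi_def)
qed

theorem theorem4p1:
  fixes q :: nat
  assumes "card (UNIV :: 'a set) = q"
  shows "(ker_pi q :: ('a::{field, finite}) mpoly set) = ideal_gen (gens q)"
proof (intro equalityI subsetI)
  fix p :: "'a mpoly" assume p: "p \<in> ker_pi q"
  have q: "q > 1"
    using card_field_ge_2[where 'a = 'a] assms by simp
  obtain r where r: "\<forall>m\<in>Poly_Mapping.keys r. normal q m" "p - r \<in> ideal_gen (gens q)"
    using S_ring_reducible[OF q] p unfolding ker_pi_def reducible_def by blast
  \<comment> \<open>The inclusion of the ideal in the kernel also serves the converse: it transfers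
    the vanishing from \<open>p\<close> to its normal form \<open>r\<close>.\<close>
  have "piS q (p - r) = 0"
    using ideal_gen_subset_ker[OF assms r(2)] by (simp add: ker_pi_def)
  then have "piS q r = 0"
    using p by (simp add: piS_def ker_pi_def subst_diff)
  then have "r = 0"
    by (rule normal_piS_eq_0[OF q r(1)])
  then show "p \<in> ideal_gen (gens q)"
    using r(2) by simp
qed (rule ideal_gen_subset_ker[OF assms])

end
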